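(* Let $\{\lambda_k\}_{k\ge 0}$ be weight parameters, $\{\beta_k\}_{k\ge -1}$ scaling parameters, $\{x_k\}_{k\ge0}\subset Q$ test points, and $l_f(y;x)$ a lower convex approximation of $f$ on $Q$. Let $\{\psi_k\}_{k\ge -1}$ be any sequence of auxiliary functions constructed as follows: $\psi_{-1}(x):=\beta_{-1}d(x)$, and for each $k\ge -1$, with $z_k:=\operatorname{argmin}_{x\in Q}\psi_k(x)$, the function $\psi_{k+1}$ is defined by either one (chosen freely and independently for each $k$) of the following two rules: (extended Mirror-Descent model) $\ \psi_{k+1}(x):=\min_{z\in Q}\psi_k(z)+\lambda_{k+1}l_f(x_{k+1};x)+\beta_{k+1}d(x)-\beta_k l_d(z_k;x)$; (Dual-Averaging model) $\ \psi_{k+1}(x):=\psi_k(x)+\lambda_{k+1}l_f(x_{k+1};x)+\beta_{k+1}d(x)-\beta_k d(x)$. Then $\{\psi_k\}_{k\ge -1}$ satisfies Property 1, i.e.: (i) $\min_{x\in Q}\psi_{-1}(x)=0$ and $z_{-1}=x_0$; (ii) for every $k\ge -1$ and all $x\in Q$, $\ \psi_{k+1}(x)\ge \min_{z\in Q}\psi_k(z)+\lambda_{k+1}l_f(x_{k+1};x)+\beta_{k+1}d(x)-\beta_k l_d(z_k;x)$; (iii) for every $k\ge 0$, $\ \min_{x\in Q}\psi_k(x)\le \inf_{x\in Q}\left\{\sum_{i=0}^k\lambda_i l_f(x_i;x)+\beta_k l_d(z_k;x)\right\}$.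
   Context: $E$ is a finite-dimensional real vector space with norm $\|\cdot\|$, $E^*$ its dual, $\langle s,x\rangle$ the value of $s\in E^*$ at $x\in E$. $Q\subset E$ is a nonempty closed convex (possibly unbounded) set, and $f:E\to\mathbb{R}\cup\{+\infty\}$ is a proper lower semicontinuous convex function with $Q\subset\operatorname{dom} f$. Prox-function: $d:E\to\mathbb{R}\cup\{+\infty\}$ is a fixed proper lower semicontinuous convex function which is continuously differentiable on $Q$ (in particular finite on $Q$) and strongly convex on $Q$ with parameter $\sigma>0$, i.e. $d(\tau x+(1-\tau)y)\le \tau d(x)+(1-\tau)d(y)-\frac12\sigma\tau(1-\tau)\|x-y\|^2$ for all $x,y\in Q$, $\tau\in[0,1]$. Put $x_0:=\operatorname{argmin}_{x\in Q}d(x)$; it is assumed that $d(x_0)=\min_{x\in Q}d(x)=0$. For $y\in Q$, $l_d(y;x):=d(y)+\langle\nabla d(y),x-y\rangle$. A lower convex approximation of $f$ on $Q$ is a family of proper lower semicontinuous convex functions $l_f(y;\cdot):E\to\mathbb{R}\cup\{+\infty\}$, $y\in Q$, with $f(x)\ge l_f(y;x)$ for all $x\in Q$. Weight parameters: $\lambda_k>0$ for $k\ge0$. Scaling parameters: $\beta_k\ge\beta_{k-1}>0$ for $k\ge 0$. Test points: a sequence $\{x_k\}_{k\ge0}\subset Q$ whose first element is $x_0=\operatorname{argmin}_{x\in Q}d(x)$. (Under either rule each $\psi_k$ is a strongly convex proper lower semicontinuous function on $Q$ and so has a unique minimizer $z_k$ over $Q$.) *)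

theory Defs
  imports "HOL-Analysis.Analysis"
begin

definition finite_dimensional :: "'a::real_vector itself \<Rightarrow> bool" where
  "finite_dimensional _ \<longleftrightarrow> (\<exists>B::'a set. finite B \<and> span B = UNIV)"

text \<open>Functions with values in the reals extended by plus infinity are modelled as
  \<^typ>\<open>ereal\<close>-valued functions that never take the value minus infinity.\<close>

definition proper_fun :: "('a \<Rightarrow> ereal) \<Rightarrow> bool" where
  "proper_fun f \<longleftrightarrow> (\<forall>u. f u \<noteq> -\<infinity>) \<and> (\<exists>u. f u \<noteq> \<infinity>)"

definition lower_semicontinuous :: "('a::topological_space \<Rightarrow> ereal) \<Rightarrow> bool" where
  "lower_semicontinuous f \<longleftrightarrow> (\<forall>u. f u \<le> Liminf (at u) f)"

definition ext_convex :: "('a::real_vector \<Rightarrow> ereal) \<Rightarrow> bool" where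
  "ext_convex f \<longleftrightarrow> (\<forall>u v. \<forall>\<tau>\<in>{0..1}.
     f (\<tau> *\<^sub>R u + (1 - \<tau>) *\<^sub>R v) \<le> ereal \<tau> * f u + ereal (1 - \<tau>) * f v)"

definition proper_lsc_convex :: "('a::real_normed_vector \<Rightarrow> ereal) \<Rightarrow> bool" where
  "proper_lsc_convex f \<longleftrightarrow> proper_fun f \<and> lower_semicontinuous f \<and> ext_convex f"

definition eff_dom :: "('a \<Rightarrow> ereal) \<Rightarrow> 'a set" where
  "eff_dom f = {u. f u < \<infinity>}"

definition strongly_convex_on :: "'a::real_normed_vector set \<Rightarrow> real \<Rightarrow> ('a \<Rightarrow> ereal) \<Rightarrow> bool" where
  "strongly_convex_on Q \<sigma> d \<longleftrightarrow> (\<forall>u\<in>Q. \<forall>v\<in>Q. \<forall>\<tau>\<in>{0..1}.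
     d (\<tau> *\<^sub>R u + (1 - \<tau>) *\<^sub>R v)
       \<le> ereal \<tau> * d u + ereal (1 - \<tau>) * d v - ereal (1/2 * \<sigma> * \<tau> * (1 - \<tau>) * (norm (u - v))\<^sup>2))"

text \<open>\<open>gd\<close> is a continuous gradient of \<open>d\<close> on \<open>Q\<close>, with values in the dual space.
  Differentiability is taken relative to \<open>Q\<close>, so that \<open>Q\<close> may meet the boundary of the domain of \<open>d\<close>
  or have empty interior; a gradient in the whole space is a special case. If \<open>gd y\<close> is not unique,
  its values at the differences \<open>u - y\<close> with \<open>u \<in> Q\<close> still are, by convexity of \<open>Q\<close>.\<close>

definition continuous_gradient_on ::
    "'a::real_normed_vector set \<Rightarrow> ('a \<Rightarrow> ereal) \<Rightarrow> ('a \<Rightarrow> ('a \<Rightarrow>\<^sub>L real)) \<Rightarrow> bool" where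
  "continuous_gradient_on Q d gd \<longleftrightarrow>
     (\<forall>y\<in>Q. ((\<lambda>u. real_of_ereal (d u)) has_derivative blinfun_apply (gd y)) (at y within Q)) \<and>
     continuous_on Q gd"

definition prox_function ::
    "'a::real_normed_vector set \<Rightarrow> real \<Rightarrow> ('a \<Rightarrow> ereal) \<Rightarrow> ('a \<Rightarrow> ('a \<Rightarrow>\<^sub>L real)) \<Rightarrow> bool" where
  "prox_function Q \<sigma> d gd \<longleftrightarrow>
     proper_lsc_convex d \<and> Q \<subseteq> eff_dom d \<and> continuous_gradient_on Q d gd \<and>
     \<sigma> > 0 \<and> strongly_convex_on Q \<sigma> d \<and> d (arg_min_on d Q) = 0"

text \<open>The linearization \<open>l_d(y; u)\<close> of \<open>d\<close> at \<open>y\<close>.\<close>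

definition linearization ::
    "('a::real_normed_vector \<Rightarrow> ereal) \<Rightarrow> ('a \<Rightarrow> ('a \<Rightarrow>\<^sub>L real)) \<Rightarrow> 'a \<Rightarrow> 'a \<Rightarrow> ereal" where
  "linearization d gd y u = d y + ereal (blinfun_apply (gd y) (u - y))"

definition lower_convex_approximation ::
    "'a::real_normed_vector set \<Rightarrow> ('a \<Rightarrow> ereal) \<Rightarrow> ('a \<Rightarrow> 'a \<Rightarrow> ereal) \<Rightarrow> bool" where
  "lower_convex_approximation Q f lf \<longleftrightarrow>
     (\<forall>y\<in>Q. proper_lsc_convex (lf y) \<and> (\<forall>u\<in>Q. f u \<ge> lf y u))"

text \<open>Sequences are indexed by integers, only indices from -1 (for \<open>\<beta>\<close>, \<open>\<psi>\<close>) or from 0 (for \<open>lam\<close>, \<open>x\<close>)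
  being relevant. The functions \<open>\<psi> k\<close> matter only on \<open>Q\<close>, where all terms below are finite; the two
  rules are therefore imposed on \<open>Q\<close> only, which avoids differences of infinities outside of it. The minimizer \<open>z\<^sub>k\<close> is
  \<open>arg_min_on (\<psi> k) Q\<close>; its existence and uniqueness are not assumed.\<close>

definition mirror_descent_value ::
    "'a::real_normed_vector set \<Rightarrow> ('a \<Rightarrow> ereal) \<Rightarrow> ('a \<Rightarrow> ('a \<Rightarrow>\<^sub>L real)) \<Rightarrow> ('a \<Rightarrow> 'a \<Rightarrow> ereal) \<Rightarrow>
     (int \<Rightarrow> real) \<Rightarrow> (int \<Rightarrow> real) \<Rightarrow> (int \<Rightarrow> 'a) \<Rightarrow> (int \<Rightarrow> 'a \<Rightarrow> ereal) \<Rightarrow> int \<Rightarrow> 'a \<Rightarrow> ereal" where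
  "mirror_descent_value Q d gd lf lam \<beta> x \<psi> k u =
     (INF z\<in>Q. \<psi> k z) + ereal (lam (k + 1)) * lf (x (k + 1)) u + ereal (\<beta> (k + 1)) * d u
       - ereal (\<beta> k) * linearization d gd (arg_min_on (\<psi> k) Q) u"

definition dual_averaging_value ::
    "('a::real_normed_vector \<Rightarrow> ereal) \<Rightarrow> ('a \<Rightarrow> 'a \<Rightarrow> ereal) \<Rightarrow>
     (int \<Rightarrow> real) \<Rightarrow> (int \<Rightarrow> real) \<Rightarrow> (int \<Rightarrow> 'a) \<Rightarrow> (int \<Rightarrow> 'a \<Rightarrow> ereal) \<Rightarrow> int \<Rightarrow> 'a \<Rightarrow> ereal" where
  "dual_averaging_value d lf lam \<beta> x \<psi> k u =
     \<psi> k u + ereal (lam (k + 1)) * lf (x (k + 1)) u + ereal (\<beta> (k + 1)) * d u - ereal (\<beta> k) * d u"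

definition auxiliary_functions ::
    "'a::real_normed_vector set \<Rightarrow> ('a \<Rightarrow> ereal) \<Rightarrow> ('a \<Rightarrow> ('a \<Rightarrow>\<^sub>L real)) \<Rightarrow> ('a \<Rightarrow> 'a \<Rightarrow> ereal) \<Rightarrow>
     (int \<Rightarrow> real) \<Rightarrow> (int \<Rightarrow> real) \<Rightarrow> (int \<Rightarrow> 'a) \<Rightarrow> (int \<Rightarrow> 'a \<Rightarrow> ereal) \<Rightarrow> bool" where
  "auxiliary_functions Q d gd lf lam \<beta> x \<psi> \<longleftrightarrow>
     (\<forall>u\<in>Q. \<psi> (-1) u = ereal (\<beta> (-1)) * d u) \<and>
     (\<forall>k\<ge>-1. (\<forall>u\<in>Q. \<psi> (k + 1) u = mirror_descent_value Q d gd lf lam \<beta> x \<psi> k u) \<or>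
              (\<forall>u\<in>Q. \<psi> (k + 1) u = dual_averaging_value d lf lam \<beta> x \<psi> k u))"

definition property_1 ::
    "'a::real_normed_vector set \<Rightarrow> ('a \<Rightarrow> ereal) \<Rightarrow> ('a \<Rightarrow> ('a \<Rightarrow>\<^sub>L real)) \<Rightarrow> ('a \<Rightarrow> 'a \<Rightarrow> ereal) \<Rightarrow>
     (int \<Rightarrow> real) \<Rightarrow> (int \<Rightarrow> real) \<Rightarrow> (int \<Rightarrow> 'a) \<Rightarrow> (int \<Rightarrow> 'a \<Rightarrow> ereal) \<Rightarrow> bool" where
  "property_1 Q d gd lf lam \<beta> x \<psi> \<longleftrightarrow>
     ((INF u\<in>Q. \<psi> (-1) u) = 0 \<and> arg_min_on (\<psi> (-1)) Q = x 0) \<and>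
     (\<forall>k\<ge>-1. \<forall>u\<in>Q. \<psi> (k + 1) u \<ge> mirror_descent_value Q d gd lf lam \<beta> x \<psi> k u) \<and>
     (\<forall>k\<ge>0. (INF u\<in>Q. \<psi> k u) \<le>
        (INF u\<in>Q. (\<Sum>i=0..k. ereal (lam i) * lf (x i) u)
                   + ereal (\<beta> k) * linearization d gd (arg_min_on (\<psi> k) Q) u))"

end

theory Submission
  imports Defs
begin

text \<open>Both rules preserve one decomposition: on \<open>Q\<close>, the auxiliary function is
  \<open>\<psi>\<^sub>k = h\<^sub>k + \<beta>\<^sub>k d\<close> with \<open>h\<^sub>k\<close> convex, lower semicontinuous and bounded above by
  \<open>\<Sum>i\<le>k. \<lambda>\<^sub>i l\<^sub>f(x\<^sub>i; \<cdot>)\<close>. Everything else follows from this decomposition at a single index.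

  Since \<open>\<beta>\<^sub>k > 0\<close>, \<open>\<psi>\<^sub>k\<close> inherits strong convexity and lower semicontinuity, so it has a unique
  minimizer \<open>z\<^sub>k\<close> (\<open>strongly_convex_lsc_unique_minimizer\<close>). Differentiating \<open>d\<close> along the segment from
  \<open>z\<^sub>k\<close> to \<open>u\<close> gives the first-order optimality condition (\<open>minimizer_first_order\<close>)
  \<open>h\<^sub>k(z\<^sub>k) \<le> h\<^sub>k(u) + \<beta>\<^sub>k \<langle>\<nabla>d(z\<^sub>k), u - z\<^sub>k\<rangle>\<close>, or, after adding \<open>\<beta>\<^sub>k d(z\<^sub>k)\<close> on both sides,
  \<open>min \<psi>\<^sub>k \<le> h\<^sub>k(u) + \<beta>\<^sub>k l\<^sub>d(z\<^sub>k; u)\<close>.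

  Combined with the bound on \<open>h\<^sub>k\<close>, this inequality is part (iii). It also says that
  \<open>a(u) = min \<psi>\<^sub>k - \<beta>\<^sub>k l\<^sub>d(z\<^sub>k; u)\<close> is an affine minorant of \<open>h\<^sub>k\<close>. The two rules differ only in that
  the new convex part is \<open>a + \<lambda> l\<^sub>f\<close> for mirror descent and \<open>h\<^sub>k + \<lambda> l\<^sub>f\<close> for dual averaging; hence
  dual averaging dominates mirror descent, which is part (ii), and in both cases the new convex part
  satisfies the bound for the next index (\<open>auxiliary_function_step\<close>).\<close>

section \<open>Lower semicontinuity of real functions relative to a set\<close>

definition lsc_on :: "'a::topological_space set \<Rightarrow> ('a \<Rightarrow> real) \<Rightarrow> bool" where
  "lsc_on Q h \<longleftrightarrow> (\<forall>u\<in>Q. \<forall>c<h u. \<forall>\<^sub>F v in at u within Q. c < h v)"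

lemma lsc_on_add:
  assumes "lsc_on Q g" "lsc_on Q h"
  shows "lsc_on Q (\<lambda>u. g u + h u)"
  unfolding lsc_on_def
proof (intro ballI allI impI)
  fix u c assume u: "u \<in> Q" and c: "c < g u + h u"
  define e where "e = (g u + h u - c) / 2"
  have "e > 0" using c by (simp add: e_def)
  then have "\<forall>\<^sub>F v in at u within Q. g u - e < g v" "\<forall>\<^sub>F v in at u within Q. h u - e < h v"
    using assms u unfolding lsc_on_def by simp_all
  then show "\<forall>\<^sub>F v in at u within Q. c < g v + h v"
    by eventually_elim (simp add: e_def field_simps)
qed

lemma lsc_on_cmult:
  assumes "lsc_on Q h" "c > 0"
  shows "lsc_on Q (\<lambda>u. c * h u)"
  unfolding lsc_on_def
proof (intro ballI allI impI)
  fix u b assume u: "u \<in> Q" and b: "b < c * h u"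
  then have "b / c < h u" using \<open>c > 0\<close> by (simp add: field_simps)
  then have "\<forall>\<^sub>F v in at u within Q. b / c < h v"
    using assms u unfolding lsc_on_def by simp
  then show "\<forall>\<^sub>F v in at u within Q. b < c * h v"
    by eventually_elim (use \<open>c > 0\<close> in \<open>simp add: field_simps\<close>)
qed

lemma continuous_on_imp_lsc_on:
  assumes "continuous_on Q h"
  shows "lsc_on Q h"
  unfolding lsc_on_def
  using assms by (auto simp: continuous_on_def dest: order_tendstoD(1))

lemma lower_semicontinuous_imp_lsc_on:
  assumes "lower_semicontinuous F" and eq: "\<And>u. u \<in> Q \<Longrightarrow> F u = ereal (h u)"
  shows "lsc_on Q h"
  unfolding lsc_on_def
proof (intro ballI allI impI)
  fix u c assume u: "u \<in> Q" and c: "c < h u"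
  have "ereal c < Liminf (at u) F"
    using c eq[OF u] assms(1) unfolding lower_semicontinuous_def
    by (metis less_ereal.simps(1) order_less_le_trans)
  then have "\<forall>\<^sub>F v in at u. ereal c < F v"
    by (rule less_LiminfD)
  then have "\<forall>\<^sub>F v in at u within Q. ereal c < F v"
    by (auto simp: eventually_at_filter elim: eventually_mono)
  moreover have "\<forall>\<^sub>F v in at u within Q. v \<in> Q"
    by (simp add: eventually_at_filter)
  ultimately show "\<forall>\<^sub>F v in at u within Q. c < h v"
    by eventually_elim (use eq in auto)
qed

lemma lsc_on_bound_along_sequence:
  assumes "lsc_on Q h" "z \<in> Q" "\<And>n. w n \<in> Q" "w \<longlonglongrightarrow> z"
    and "(\<lambda>n. h (w n)) \<longlonglongrightarrow> m"
  shows "h z \<le> m"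
proof (rule ccontr)
  assume "\<not> h z \<le> m"
  then obtain c where c: "m < c" "c < h z" using dense not_le by blast
  from assms(1,2) c have "\<forall>\<^sub>F v in at z within Q. c < h v"
    unfolding lsc_on_def by blast
  then have "\<forall>\<^sub>F v in nhds z. v \<in> Q \<longrightarrow> c < h v"
    unfolding eventually_at_filter by (rule eventually_mono) (use c(2) in auto)
  then have "\<forall>\<^sub>F n in sequentially. w n \<in> Q \<longrightarrow> c < h (w n)"
    using assms(4) by (rule eventually_compose_filterlim)
  then have "\<forall>\<^sub>F n in sequentially. c \<le> h (w n)"
    by eventually_elim (simp add: assms(3) less_imp_le)
  then have "c \<le> m"
    using assms(5) by (intro tendsto_lowerbound) auto
  with c show False by simp
qed

section \<open>Completeness of finite-dimensional normed spaces\<close>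

lemma Cauchy_diff:
  fixes X Y :: "nat \<Rightarrow> 'a::real_normed_vector"
  assumes "Cauchy X" "Cauchy Y"
  shows "Cauchy (\<lambda>n. X n - Y n)"
  using bounded_linear.Cauchy[OF bounded_linear_sub[OF bounded_linear_fst bounded_linear_snd]
      Cauchy_Pair[OF assms]] by simp

text \<open>If \<open>a\<close> lies outside the closed subspace \<open>S\<close>, it has positive distance from \<open>S\<close>, so the
  coefficient of \<open>a\<close> in a vector of \<open>S + \<real> a\<close> is controlled by the norm of that vector. Thus a
  Cauchy sequence has Cauchy coefficients, and its components in \<open>S\<close> are Cauchy as well. The set is
  written in the form in which \<open>span_insert\<close> presents the span of an enlarged set.\<close>

lemma complete_subspace_insert:
  fixes S :: "'a::real_normed_vector set"
  assumes S: "subspace S" "complete S"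
  shows "complete {v. \<exists>k. v - k *\<^sub>R a \<in> S}"
proof (cases "a \<in> S")
  case True
  have "v \<in> S" if "v - k *\<^sub>R a \<in> S" for v k
    using subspace_add[OF S(1) that subspace_scale[OF S(1) True, of k]] by simp
  then have "{v. \<exists>k. v - k *\<^sub>R a \<in> S} = S"
    by (force intro: exI[of _ 0])
  with S(2) show ?thesis by simp
next
  case False
  have "closed S" using S(2) by (rule complete_imp_closed)
  with False obtain r where "r > 0" "\<forall>y. dist y a < r \<longrightarrow> y \<in> - S"
    by (metis Compl_iff open_Compl open_dist)
  then have r: "r > 0" "\<And>y. y \<in> S \<Longrightarrow> r \<le> dist a y"
    by (auto simp: dist_commute not_less[symmetric])
  have bound: "\<bar>k\<bar> * r \<le> norm (s + k *\<^sub>R a)" if "s \<in> S" for s k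
  proof (cases "k = 0")
    case False
    have "(- inverse k) *\<^sub>R s \<in> S" using S(1) that subspace_scale by blast
    then have "r \<le> norm (a + inverse k *\<^sub>R s)"
      using r(2) by (fastforce simp: dist_norm)
    then have "\<bar>k\<bar> * r \<le> norm (k *\<^sub>R (a + inverse k *\<^sub>R s))"
      by (simp add: mult_left_mono)
    also have "k *\<^sub>R (a + inverse k *\<^sub>R s) = s + k *\<^sub>R a"
      using False by (simp add: scaleR_add_right add.commute)
    finally show ?thesis .
  qed simp
  show ?thesis
    unfolding complete_def
  proof (intro allI impI)
    fix v :: "nat \<Rightarrow> 'a"
    assume v: "(\<forall>n. v n \<in> {v. \<exists>k. v - k *\<^sub>R a \<in> S}) \<and> Cauchy v"
    then obtain k where k: "\<And>n. v n - k n *\<^sub>R a \<in> S"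
      by simp metis
    have "Cauchy k"
    proof (rule metric_CauchyI)
      fix e :: real assume "e > 0"
      then have "e * r > 0" using r(1) by simp
      then obtain M where M: "\<And>m n. m \<ge> M \<Longrightarrow> n \<ge> M \<Longrightarrow> dist (v m) (v n) < e * r"
        using v metric_CauchyD by metis
      show "\<exists>M. \<forall>m\<ge>M. \<forall>n\<ge>M. dist (k m) (k n) < e"
      proof (intro exI allI impI)
        fix m n assume mn: "M \<le> m" "M \<le> n"
        have "(v m - k m *\<^sub>R a) - (v n - k n *\<^sub>R a) \<in> S"
          using k S(1) subspace_diff by blast
        from bound[OF this, of "k m - k n"]
        have "\<bar>k m - k n\<bar> * r \<le> norm (v m - v n)"
          by (simp add: algebra_simps)
        also have "\<dots> < e * r" using M[OF mn] by (simp add: dist_norm)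
        finally show "dist (k m) (k n) < e"
          using r(1) by (simp add: dist_real_def)
      qed
    qed
    then obtain l where l: "k \<longlonglongrightarrow> l" using Cauchy_convergent convergent_def by blast
    then have ka: "(\<lambda>n. k n *\<^sub>R a) \<longlonglongrightarrow> l *\<^sub>R a"
      by (intro tendsto_intros)
    then have "Cauchy (\<lambda>n. k n *\<^sub>R a)" by (rule LIMSEQ_imp_Cauchy)
    with v have "Cauchy (\<lambda>n. v n - k n *\<^sub>R a)" by (simp add: Cauchy_diff)
    with S(2) k obtain s where s: "s \<in> S" "(\<lambda>n. v n - k n *\<^sub>R a) \<longlonglongrightarrow> s"
      unfolding complete_def by (metis (no_types, lifting))
    from tendsto_add[OF s(2) ka] have "v \<longlonglongrightarrow> s + l *\<^sub>R a" by simp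
    moreover have "s + l *\<^sub>R a \<in> {v. \<exists>k. v - k *\<^sub>R a \<in> S}" using s(1) by (auto intro: exI[of _ l])
    ultimately show "\<exists>l\<in>{v. \<exists>k. v - k *\<^sub>R a \<in> S}. v \<longlonglongrightarrow> l" by blast
  qed
qed

lemma complete_span_finite:
  fixes B :: "'a::real_normed_vector set"
  assumes "finite B"
  shows "complete (span B)"
  using assms
proof induction
  case empty
  then show ?case by (simp add: compact_imp_complete)
next
  case (insert a B)
  then show ?case
    using complete_subspace_insert[OF subspace_span] by (simp add: span_insert)
qed

lemma finite_dimensional_imp_complete:
  assumes "finite_dimensional TYPE('a::real_normed_vector)"
  shows "complete (UNIV :: 'a set)"
  using assms complete_span_finite unfolding finite_dimensional_def by metis

section \<open>Minimizers of strongly convex functions\<close>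

text \<open>Lower semicontinuity at one point \<open>w\<close> bounds \<open>p\<close> below on a small ball around \<open>w\<close>. A point
  \<open>u\<close> outside the ball is compared with the point where the segment from \<open>w\<close> to \<open>u\<close> leaves it:
  strong convexity then bounds \<open>p u\<close> below by a quadratic in \<open>norm (u - w)\<close> with positive leading
  coefficient.\<close>

lemma strongly_convex_lsc_bounded_below:
  fixes p :: "'a::real_normed_vector \<Rightarrow> real"
  assumes Q: "convex Q" and c: "c > 0" and lsc: "lsc_on Q p"
    and sc: "\<And>u v t. u \<in> Q \<Longrightarrow> v \<in> Q \<Longrightarrow> 0 \<le> t \<Longrightarrow> t \<le> 1 \<Longrightarrow>
      p (t *\<^sub>R u + (1 - t) *\<^sub>R v) \<le> t * p u + (1 - t) * p v - c * t * (1 - t) * (norm (u - v))\<^sup>2"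
  shows "bdd_below (p ` Q)"
proof (cases "Q = {}")
  case False
  then obtain w where w: "w \<in> Q" by blast
  from lsc w have "\<forall>\<^sub>F v in at w within Q. p w - 1 < p v"
    unfolding lsc_on_def by simp
  then obtain r where r: "r > 0" "\<And>v. v \<in> Q \<Longrightarrow> v \<noteq> w \<Longrightarrow> dist v w < r \<Longrightarrow> p w - 1 < p v"
    unfolding eventually_at by auto
  define s where "s = r / 2"
  have s: "s > 0" using r by (simp add: s_def)
  have near: "p w - 1 \<le> p v" if "v \<in> Q" "norm (v - w) \<le> s" for v
    using r that by (cases "v = w") (fastforce simp: dist_norm s_def)+
  \<comment> \<open>The quadratic bound is \<open>p w - K R + c R\<^sup>2\<close> with \<open>R = norm (u - w)\<close>; its minimum over \<open>R\<close> is
    \<open>p w - K\<^sup>2 / (4 c)\<close>.\<close>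
  define K where "K = 1 / s + c * s"
  have far: "p w - K\<^sup>2 / (4 * c) \<le> p u" if u: "u \<in> Q" "norm (u - w) > s" for u
  proof -
    define R where "R = norm (u - w)"
    define t where "t = s / R"
    have R: "R > s" using u by (simp add: R_def)
    have t: "0 < t" "t < 1" "t * R = s" using s R by (simp_all add: t_def)
    let ?v = "t *\<^sub>R u + (1 - t) *\<^sub>R w"
    have "?v - w = t *\<^sub>R (u - w)" by (simp add: algebra_simps)
    then have "norm (?v - w) = s" using t by (simp add: R_def)
    moreover have "?v \<in> Q" using Q u w t by (simp add: convexD)
    ultimately have "p w - 1 \<le> p ?v" using near by simp
    also have "\<dots> \<le> t * p u + (1 - t) * p w - c * t * (1 - t) * R\<^sup>2"
      using sc[OF u(1) w] t by (simp add: R_def)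
    finally have "t * (p w - p u) \<le> 1 - c * t * (1 - t) * R\<^sup>2"
      by (simp add: algebra_simps)
    also have "\<dots> = t * (R / s - c * (1 - t) * R\<^sup>2)"
      using t s R by (simp add: t_def field_simps)
    finally have "p w - p u \<le> R / s - c * (1 - t) * R\<^sup>2" using t by simp
    also have "\<dots> = R / s - c * R\<^sup>2 + c * (t * R) * R" by (simp add: algebra_simps power2_eq_square)
    also have "\<dots> = K * R - c * R\<^sup>2" unfolding t(3) by (simp add: K_def algebra_simps)
    also have "\<dots> \<le> K\<^sup>2 / (4 * c)"
    proof -
      have "0 \<le> (K - 2 * c * R)\<^sup>2" by simp
      then have "(K * R - c * R\<^sup>2) * (4 * c) \<le> K\<^sup>2" by (simp add: power2_eq_square algebra_simps)
      then show ?thesis using c by (simp add: pos_le_divide_eq)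
    qed
    finally show ?thesis by simp
  qed
  have "min (p w - 1) (p w - K\<^sup>2 / (4 * c)) \<le> p u" if "u \<in> Q" for u
    using near[OF that] far[OF that] by (cases "norm (u - w) \<le> s") auto
  then show ?thesis by (intro bdd_belowI2)
qed simp

text \<open>Strong convexity at midpoints forces two points whose values are within \<open>e\<close> of the infimum to
  lie at distance at most \<open>2 * sqrt (e / c)\<close>. So minimizing sequences are Cauchy and minimizers are
  unique; completeness thereby takes the place of compactness of the sublevel sets.\<close>

lemma strongly_convex_lsc_unique_minimizer:
  fixes p :: "'a::real_normed_vector \<Rightarrow> real"
  assumes Q: "complete Q" "convex Q" "Q \<noteq> {}" and c: "c > 0" and lsc: "lsc_on Q p"
    and sc: "\<And>u v t. u \<in> Q \<Longrightarrow> v \<in> Q \<Longrightarrow> 0 \<le> t \<Longrightarrow> t \<le> 1 \<Longrightarrow>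
      p (t *\<^sub>R u + (1 - t) *\<^sub>R v) \<le> t * p u + (1 - t) * p v - c * t * (1 - t) * (norm (u - v))\<^sup>2"
  shows "\<exists>!z. z \<in> Q \<and> (\<forall>u\<in>Q. p z \<le> p u)"
proof -
  define m where "m = (INF u\<in>Q. p u)"
  have bdd: "bdd_below (p ` Q)"
    by (rule strongly_convex_lsc_bounded_below[OF Q(2) c lsc sc])
  then have m_le: "m \<le> p u" if "u \<in> Q" for u
    unfolding m_def using that by (rule cINF_lower)
  have gap: "c * (norm (u - v))\<^sup>2 \<le> 4 * e" if "u \<in> Q" "v \<in> Q" "p u \<le> m + e" "p v \<le> m + e" for u v e
  proof -
    have "(1/2) *\<^sub>R u + (1 - 1/2) *\<^sub>R v \<in> Q" using Q(2) that by (intro convexD) auto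
    from m_le[OF this] sc[OF that(1,2), of "1/2"] that(3,4) show ?thesis by simp
  qed
  have "\<exists>u\<in>Q. p u < m + 1 / real (Suc n)" for n
    using cINF_less_iff[OF Q(3) bdd, of "m + 1 / real (Suc n)"] unfolding m_def by simp
  then obtain w where w: "\<And>n. w n \<in> Q" "\<And>n. p (w n) < m + 1 / real (Suc n)" by metis
  have lim: "(\<lambda>n. p (w n)) \<longlonglongrightarrow> m"
  proof (rule tendsto_sandwich[of "\<lambda>_. m"])
    show "(\<lambda>n. m + 1 / real (Suc n)) \<longlonglongrightarrow> m"
      using tendsto_add[OF tendsto_const[of m] LIMSEQ_Suc[OF lim_1_over_n]] by simp
    show "\<forall>\<^sub>F n in sequentially. p (w n) \<le> m + 1 / real (Suc n)"
      by (intro always_eventually allI less_imp_le w(2))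
  qed (use m_le w(1) in auto)
  have "Cauchy w"
  proof (rule metric_CauchyI)
    fix e :: real assume e: "e > 0"
    then have "c * e\<^sup>2 / 8 > 0" using c by simp
    then obtain M where M: "inverse (real (Suc M)) < c * e\<^sup>2 / 8" using reals_Archimedean by blast
    have small: "p (w n) \<le> m + c * e\<^sup>2 / 8" if "n \<ge> M" for n
    proof -
      have "1 / real (Suc n) \<le> inverse (real (Suc M))" using that by (simp add: field_simps)
      with M w(2)[of n] show ?thesis by linarith
    qed
    show "\<exists>M. \<forall>i\<ge>M. \<forall>n\<ge>M. dist (w i) (w n) < e"
    proof (intro exI allI impI)
      fix i n assume "M \<le> i" "M \<le> n"
      then have "c * (norm (w i - w n))\<^sup>2 \<le> 4 * (c * e\<^sup>2 / 8)"
        by (intro gap w(1) small)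
      also have "\<dots> < c * e\<^sup>2" using c e by simp
      finally have "(norm (w i - w n))\<^sup>2 < e\<^sup>2" using c by simp
      then show "dist (w i) (w n) < e" using e by (simp add: dist_norm power2_less_imp_less)
    qed
  qed
  with Q(1) w(1) obtain z where z: "z \<in> Q" "w \<longlonglongrightarrow> z"
    unfolding complete_def by metis
  have pz: "p z \<le> m" by (rule lsc_on_bound_along_sequence[OF lsc z(1) w(1) z(2) lim])
  show ?thesis
  proof (rule ex1I[of _ z])
    show "z \<in> Q \<and> (\<forall>u\<in>Q. p z \<le> p u)" using z pz m_le order_trans by blast
    fix y assume "y \<in> Q \<and> (\<forall>u\<in>Q. p y \<le> p u)"
    then have "c * (norm (y - z))\<^sup>2 \<le> 4 * 0" using z pz by (intro gap) auto
    then show "y = z" using c by (simp add: mult_le_0_iff)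
  qed
qed

text \<open>Moving from the minimizer \<open>z\<close> towards \<open>u\<close> by a fraction \<open>t\<close> changes \<open>h\<close> by at most
  \<open>t * (h u - h z)\<close>, by convexity, while \<open>h + b D\<close> does not decrease. Dividing by \<open>t\<close> and letting
  \<open>t\<close> tend to \<open>0\<close> replaces the change of \<open>D\<close> by its directional derivative. Since the segment stays
  in \<open>Q\<close>, differentiability relative to \<open>Q\<close> is enough.\<close>

lemma minimizer_first_order:
  fixes D h :: "'a::real_normed_vector \<Rightarrow> real"
  assumes Q: "convex Q" and h: "convex_on Q h"
    and D: "(D has_derivative g) (at z within Q)"
    and z: "z \<in> Q" "\<And>v. v \<in> Q \<Longrightarrow> h z + b * D z \<le> h v + b * D v"
    and u: "u \<in> Q"
  shows "h z \<le> h u + b * g (u - z)"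
proof -
  define \<gamma> where "\<gamma> t = z + t *\<^sub>R (u - z)" for t :: real
  have \<gamma>_eq: "\<gamma> t = (1 - t) *\<^sub>R z + t *\<^sub>R u" for t by (simp add: \<gamma>_def algebra_simps)
  have \<gamma>_in: "\<gamma> t \<in> Q" if "t \<in> {0..1}" for t
    using Q z(1) u that unfolding \<gamma>_eq by (intro convexD) auto
  have "(\<gamma> has_derivative (\<lambda>t. t *\<^sub>R (u - z))) (at 0 within {0..1})"
    unfolding \<gamma>_def by (auto intro!: derivative_eq_intros)
  moreover have "(D has_derivative g) (at (\<gamma> 0) within \<gamma> ` {0..1})"
  proof (rule has_derivative_subset)
    show "(D has_derivative g) (at (\<gamma> 0) within Q)" using D by (simp add: \<gamma>_def)
    show "\<gamma> ` {0..1} \<subseteq> Q" using \<gamma>_in by blast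
  qed
  ultimately have "((\<lambda>t. D (\<gamma> t)) has_derivative (\<lambda>t. g (t *\<^sub>R (u - z)))) (at 0 within {0..1})"
    by (rule has_derivative_in_compose)
  moreover have "(\<lambda>t. g (t *\<^sub>R (u - z))) = (*) (g (u - z))"
    using D by (simp add: fun_eq_iff linear_scale has_derivative_linear mult.commute)
  ultimately have "((\<lambda>t. D (\<gamma> t)) has_field_derivative g (u - z)) (at 0 within {0..1})"
    by (simp add: has_field_derivative_def)
  then have "((\<lambda>t. (D (\<gamma> t) - D z) / t) \<longlongrightarrow> g (u - z)) (at 0 within {0..1})"
    by (simp add: has_field_derivative_iff \<gamma>_def)
  then have lim: "((\<lambda>t. b * ((D (\<gamma> t) - D z) / t)) \<longlongrightarrow> b * g (u - z)) (at 0 within {0..1})"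
    by (rule tendsto_mult_left)
  have "h z - h u \<le> b * ((D (\<gamma> t) - D z) / t)" if t: "t \<in> {0..1}" "t \<noteq> 0" for t
  proof -
    have "h z + b * D z \<le> h (\<gamma> t) + b * D (\<gamma> t)" using z(2) \<gamma>_in t by blast
    also have "h (\<gamma> t) \<le> (1 - t) * h z + t * h u"
      unfolding \<gamma>_eq using h z(1) u t by (intro convex_onD) auto
    finally have "t * (h z - h u) \<le> b * (D (\<gamma> t) - D z)" by (simp add: algebra_simps)
    then show ?thesis using t by (simp add: field_simps)
  qed
  then have "\<forall>\<^sub>F t in at 0 within {0..1}. h z - h u \<le> b * ((D (\<gamma> t) - D z) / t)"
    by (auto simp: eventually_at_filter)
  then have "h z - h u \<le> b * g (u - z)"
    using lim by (intro tendsto_lowerbound) (auto simp: trivial_limit_within islimpt_Icc)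
  then show ?thesis by simp
qed


section \<open>From extended-real to real functions on \<open>Q\<close>\<close>

lemma ext_convex_imp_convex_on:
  assumes F: "ext_convex F" and Q: "convex Q" and eq: "\<And>u. u \<in> Q \<Longrightarrow> F u = ereal (h u)"
  shows "convex_on Q h"
proof (rule convex_onI)
  fix t :: real and u v assume t: "0 < t" "t < 1" and uv: "u \<in> Q" "v \<in> Q"
  have "(1 - t) *\<^sub>R u + t *\<^sub>R v \<in> Q" using Q uv t by (intro convexD) auto
  moreover have "F ((1 - t) *\<^sub>R u + t *\<^sub>R v) \<le> ereal (1 - t) * F u + ereal t * F v"
    using F[unfolded ext_convex_def, rule_format, of "1 - t" u v] t by simp
  ultimately show "h ((1 - t) *\<^sub>R u + t *\<^sub>R v) \<le> (1 - t) * h u + t * h v"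
    using uv by (simp add: eq)
qed (rule Q)

lemma prox_function_finite:
  assumes "prox_function Q \<sigma> d gd" "u \<in> Q"
  shows "d u = ereal (real_of_ereal (d u))"
proof -
  have "d u \<noteq> -\<infinity>" "d u \<noteq> \<infinity>"
    using assms unfolding prox_function_def proper_lsc_convex_def proper_fun_def eff_dom_def by auto
  then show ?thesis by (cases "d u") auto
qed

lemma lower_convex_approximation_finite:
  assumes "lower_convex_approximation Q f lf" "Q \<subseteq> eff_dom f" "y \<in> Q" "u \<in> Q"
  shows "lf y u = ereal (real_of_ereal (lf y u))"
proof -
  have "lf y u \<noteq> -\<infinity>" "lf y u \<le> f u" "f u < \<infinity>"
    using assms
    unfolding lower_convex_approximation_def proper_lsc_convex_def proper_fun_def eff_dom_def by auto
  then show ?thesis by (cases "lf y u") auto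
qed

section \<open>The decomposition of the auxiliary functions\<close>

text \<open>The convex part \<open>h\<close> is kept real-valued and separate from \<open>b d\<close> because only \<open>d\<close> is
  differentiable: the optimality condition linearizes \<open>d\<close> and leaves \<open>h\<close> as it is.\<close>

definition has_convex_part ::
    "'a::real_normed_vector set \<Rightarrow> ('a \<Rightarrow> ereal) \<Rightarrow> real \<Rightarrow> ('a \<Rightarrow> real) \<Rightarrow> ('a \<Rightarrow> ereal) \<Rightarrow> bool" where
  "has_convex_part Q d b h P \<longleftrightarrow> convex_on Q h \<and> lsc_on Q h \<and>
     (\<forall>u\<in>Q. P u = ereal (h u + b * real_of_ereal (d u)))"

text \<open>The multiple \<open>b d\<close> contributes strong convexity, \<open>h\<close> only convexity, so the existence theorem
  applies to the sum; \<open>d\<close> is continuous on \<open>Q\<close> because it is differentiable there. The last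
  conclusion is the optimality condition from which both inequalities of Property 1 are derived.\<close>

lemma has_convex_part_minimizer:
  fixes Q :: "'a::real_normed_vector set"
  assumes Q: "complete Q" "convex Q" "Q \<noteq> {}"
    and d: "prox_function Q \<sigma> d gd"
    and b: "b > 0" and P: "has_convex_part Q d b h P"
  defines "z \<equiv> arg_min_on P Q"
  shows "\<exists>!z. is_arg_min P (\<lambda>u. u \<in> Q) z"
    and "z \<in> Q"
    and "(INF u\<in>Q. P u) = ereal (h z + b * real_of_ereal (d z))"
    and "u \<in> Q \<Longrightarrow> h z \<le> h u + b * blinfun_apply (gd z) (u - z)"
proof -
  define D where "D u = real_of_ereal (d u)" for u
  define p where "p u = h u + b * D u" for u
  have dD: "d u = ereal (D u)" if "u \<in> Q" for u
    using prox_function_finite[OF d that] by (simp add: D_def)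
  have h: "convex_on Q h" "lsc_on Q h" and Pp: "\<And>u. u \<in> Q \<Longrightarrow> P u = ereal (p u)"
    using P unfolding has_convex_part_def p_def D_def by auto
  have \<sigma>: "\<sigma> > 0" and sc_d: "strongly_convex_on Q \<sigma> d"
    and grad: "\<And>y. y \<in> Q \<Longrightarrow> (D has_derivative blinfun_apply (gd y)) (at y within Q)"
    using d unfolding prox_function_def continuous_gradient_on_def D_def by auto
  have "continuous_on Q D"
    using grad has_derivative_continuous continuous_on_eq_continuous_within by blast
  then have "lsc_on Q p"
    unfolding p_def by (rule lsc_on_add[OF h(2) lsc_on_cmult[OF continuous_on_imp_lsc_on b]])
  moreover have "p (t *\<^sub>R u + (1 - t) *\<^sub>R v)
      \<le> t * p u + (1 - t) * p v - (b * \<sigma> / 2) * t * (1 - t) * (norm (u - v))\<^sup>2"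
    if uv: "u \<in> Q" "v \<in> Q" and t: "0 \<le> t" "t \<le> 1" for u v t
  proof -
    have "t *\<^sub>R u + (1 - t) *\<^sub>R v \<in> Q" using Q(2) uv t by (intro convexD) auto
    moreover have "d (t *\<^sub>R u + (1 - t) *\<^sub>R v)
        \<le> ereal t * d u + ereal (1 - t) * d v - ereal (1/2 * \<sigma> * t * (1 - t) * (norm (u - v))\<^sup>2)"
      using sc_d uv t unfolding strongly_convex_on_def by simp
    ultimately have "D (t *\<^sub>R u + (1 - t) *\<^sub>R v)
        \<le> t * D u + (1 - t) * D v - 1/2 * \<sigma> * t * (1 - t) * (norm (u - v))\<^sup>2"
      using uv by (simp add: dD)
    from mult_left_mono[OF this, of b] b
    have "b * D (t *\<^sub>R u + (1 - t) *\<^sub>R v)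
        \<le> t * (b * D u) + (1 - t) * (b * D v) - (b * \<sigma> / 2) * t * (1 - t) * (norm (u - v))\<^sup>2"
      by (simp add: algebra_simps)
    moreover have "h (t *\<^sub>R u + (1 - t) *\<^sub>R v) \<le> t * h u + (1 - t) * h v"
      using convex_onD[OF h(1), of "1 - t" u v] uv t by simp
    ultimately show ?thesis unfolding p_def by (simp add: algebra_simps)
  qed
  ultimately have unique: "\<exists>!z. z \<in> Q \<and> (\<forall>u\<in>Q. p z \<le> p u)"
    using Q b \<sigma> by (intro strongly_convex_lsc_unique_minimizer[where c = "b * \<sigma> / 2"]) auto
  have iff: "is_arg_min P (\<lambda>u. u \<in> Q) y \<longleftrightarrow> y \<in> Q \<and> (\<forall>u\<in>Q. p y \<le> p u)" for y
    unfolding is_arg_min_def by (auto simp: Pp not_less)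
  show ex1: "\<exists>!z. is_arg_min P (\<lambda>u. u \<in> Q) z" unfolding iff by (rule unique)
  then have "is_arg_min P (\<lambda>u. u \<in> Q) z"
    unfolding z_def arg_min_on_def arg_min_def by (metis someI_ex)
  then have z: "z \<in> Q" "\<And>u. u \<in> Q \<Longrightarrow> p z \<le> p u" unfolding iff by auto
  then show "z \<in> Q" by simp
  have "(INF u\<in>Q. P u) = P z"
    using z by (intro antisym INF_lower INF_greatest) (auto simp: Pp)
  then show "(INF u\<in>Q. P u) = ereal (h z + b * real_of_ereal (d z))"
    using z(1) by (simp add: Pp p_def D_def)
  show "h z \<le> h u + b * blinfun_apply (gd z) (u - z)" if "u \<in> Q"
    using minimizer_first_order[OF Q(2) h(1) grad[OF z(1)] z(1) _ that, of b] z(2)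
    unfolding p_def by blast
qed

text \<open>By the optimality condition at \<open>z\<close>, the affine function \<open>a\<close> below satisfies \<open>a \<le> h\<close> on \<open>Q\<close>.
  The convex part of the new function is \<open>\<lambda> l\<^sub>f\<close> plus \<open>a\<close> or \<open>h\<close>, according to the rule. Hence both
  rules dominate the mirror-descent value, and neither lets the convex part exceed \<open>h + \<lambda> l\<^sub>f\<close>.\<close>

lemma auxiliary_function_step:
  fixes Q :: "'a::real_normed_vector set"
  assumes Q: "complete Q" "convex Q" "Q \<noteq> {}"
    and d: "prox_function Q \<sigma> d gd"
    and f: "Q \<subseteq> eff_dom f" and lf: "lower_convex_approximation Q f lf"
    and x: "x (k + 1) \<in> Q" and lam: "lam (k + 1) > 0" and b: "\<beta> k > 0"
    and P: "has_convex_part Q d (\<beta> k) h (\<psi> k)"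
    and step: "(\<forall>u\<in>Q. \<psi> (k + 1) u = mirror_descent_value Q d gd lf lam \<beta> x \<psi> k u) \<or>
      (\<forall>u\<in>Q. \<psi> (k + 1) u = dual_averaging_value d lf lam \<beta> x \<psi> k u)"
  shows "\<forall>u\<in>Q. \<psi> (k + 1) u \<ge> mirror_descent_value Q d gd lf lam \<beta> x \<psi> k u"
    and "\<exists>h'. has_convex_part Q d (\<beta> (k + 1)) h' (\<psi> (k + 1)) \<and>
      (\<forall>u\<in>Q. h' u \<le> h u + lam (k + 1) * real_of_ereal (lf (x (k + 1)) u))"
proof -
  define D where "D u = real_of_ereal (d u)" for u
  define L where "L u = real_of_ereal (lf (x (k + 1)) u)" for u
  define z where "z = arg_min_on (\<psi> k) Q"
  \<comment> \<open>As \<open>min \<psi>\<^sub>k = h z + \<beta>\<^sub>k d(z)\<close>, this is \<open>min \<psi>\<^sub>k - \<beta>\<^sub>k l\<^sub>d(z; u)\<close>.\<close>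
  define a where "a u = h z - \<beta> k * blinfun_apply (gd z) (u - z)" for u
  note min = has_convex_part_minimizer(2-4)[OF Q d b P, folded z_def]
  have dD: "d u = ereal (D u)" if "u \<in> Q" for u
    using prox_function_finite[OF d that] by (simp add: D_def)
  have lL: "lf (x (k + 1)) u = ereal (L u)" if "u \<in> Q" for u
    using lower_convex_approximation_finite[OF lf f x that] by (simp add: L_def)
  have h: "convex_on Q h" "lsc_on Q h" and \<psi>: "\<And>u. u \<in> Q \<Longrightarrow> \<psi> k u = ereal (h u + \<beta> k * D u)"
    using P unfolding has_convex_part_def D_def by auto
  have "proper_lsc_convex (lf (x (k + 1)))"
    using lf x unfolding lower_convex_approximation_def by blast
  then have L: "convex_on Q (\<lambda>u. lam (k + 1) * L u)" "lsc_on Q (\<lambda>u. lam (k + 1) * L u)"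
    using lL lam Q(2) unfolding proper_lsc_convex_def
    by (auto intro!: convex_on_cmul lsc_on_cmult
        intro: ext_convex_imp_convex_on lower_semicontinuous_imp_lsc_on)
  have a: "convex_on Q a" "lsc_on Q a"
  proof -
    show "convex_on Q a"
    proof (rule convex_onI)
      fix t :: real and u v
      have "(1 - t) *\<^sub>R u + t *\<^sub>R v - z = (1 - t) *\<^sub>R (u - z) + t *\<^sub>R (v - z)"
        by (simp add: algebra_simps)
      then show "a ((1 - t) *\<^sub>R u + t *\<^sub>R v) \<le> (1 - t) * a u + t * a v"
        by (simp only: a_def blinfun.add_right blinfun.scaleR_right) (simp add: algebra_simps)
    qed (rule Q(2))
    show "lsc_on Q a"
      unfolding a_def by (intro continuous_on_imp_lsc_on continuous_intros)
  qed
  have a_le: "a u \<le> h u" if "u \<in> Q" for u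
    using min(3)[OF that] by (simp add: a_def)
  have md: "mirror_descent_value Q d gd lf lam \<beta> x \<psi> k u
      = ereal (a u + lam (k + 1) * L u + \<beta> (k + 1) * D u)" if "u \<in> Q" for u
    unfolding mirror_descent_value_def linearization_def min(2) z_def[symmetric]
      dD[OF that] dD[OF min(1)] lL[OF that]
    by (simp add: a_def algebra_simps)
  have da: "dual_averaging_value d lf lam \<beta> x \<psi> k u
      = ereal (h u + lam (k + 1) * L u + \<beta> (k + 1) * D u)" if "u \<in> Q" for u
    unfolding dual_averaging_value_def dD[OF that] lL[OF that] \<psi>[OF that]
    by (simp add: algebra_simps)
  show "\<forall>u\<in>Q. \<psi> (k + 1) u \<ge> mirror_descent_value Q d gd lf lam \<beta> x \<psi> k u"
    using step
  proof
    assume "\<forall>u\<in>Q. \<psi> (k + 1) u = dual_averaging_value d lf lam \<beta> x \<psi> k u"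
    then show ?thesis using a_le by (simp add: md da)
  qed simp
  \<comment> \<open>\<open>g\<close> stands for \<open>a\<close> or \<open>h\<close>, so that the rest of the argument is common to both rules.\<close>
  from step obtain g where g: "convex_on Q g" "lsc_on Q g" "\<And>u. u \<in> Q \<Longrightarrow> g u \<le> h u"
    "\<And>u. u \<in> Q \<Longrightarrow> \<psi> (k + 1) u = ereal (g u + lam (k + 1) * L u + \<beta> (k + 1) * D u)"
  proof
    assume "\<forall>u\<in>Q. \<psi> (k + 1) u = mirror_descent_value Q d gd lf lam \<beta> x \<psi> k u"
    then show thesis using a a_le md by (intro that[of a]) auto
  next
    assume "\<forall>u\<in>Q. \<psi> (k + 1) u = dual_averaging_value d lf lam \<beta> x \<psi> k u"
    then show thesis using h da by (intro that[of h]) auto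
  qed
  show "\<exists>h'. has_convex_part Q d (\<beta> (k + 1)) h' (\<psi> (k + 1)) \<and>
      (\<forall>u\<in>Q. h' u \<le> h u + lam (k + 1) * real_of_ereal (lf (x (k + 1)) u))"
  proof (intro exI conjI)
    show "has_convex_part Q d (\<beta> (k + 1)) (\<lambda>u. g u + lam (k + 1) * L u) (\<psi> (k + 1))"
      unfolding has_convex_part_def
      using g L by (auto simp: D_def intro: convex_on_add lsc_on_add)
  qed (use g(3) in \<open>auto simp: L_def\<close>)
qed

section \<open>Property 1\<close>

theorem proposition3p3:
  fixes Q :: "'a::real_normed_vector set"
    and f d :: "'a \<Rightarrow> ereal"
    and gd :: "'a \<Rightarrow> ('a \<Rightarrow>\<^sub>L real)"
    and lf :: "'a \<Rightarrow> 'a \<Rightarrow> ereal"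
    and \<sigma> :: real
    and lam \<beta> :: "int \<Rightarrow> real"
    and x :: "int \<Rightarrow> 'a"
    and \<psi> :: "int \<Rightarrow> 'a \<Rightarrow> ereal"
  assumes "finite_dimensional TYPE('a)"
    and "Q \<noteq> {}" and "closed Q" and "convex Q"
    and "proper_lsc_convex f" and "Q \<subseteq> eff_dom f"
    and "prox_function Q \<sigma> d gd"
    and "lower_convex_approximation Q f lf"
    and "\<forall>k\<ge>0. lam k > 0"
    and "\<forall>k\<ge>0. \<beta> k \<ge> \<beta> (k - 1) \<and> \<beta> (k - 1) > 0"
    and "\<forall>k\<ge>0. x k \<in> Q" and "x 0 = arg_min_on d Q"
    and "auxiliary_functions Q d gd lf lam \<beta> x \<psi>"
  shows "(\<forall>k\<ge>-1. \<exists>!z. is_arg_min (\<psi> k) (\<lambda>u. u \<in> Q) z) \<and>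
         property_1 Q d gd lf lam \<beta> x \<psi>"
proof -
  note d = assms(7)
  have "complete (UNIV \<inter> Q)"
    using finite_dimensional_imp_complete[OF assms(1)] assms(3) by (rule complete_Int_closed)
  then have Q: "complete Q" "convex Q" "Q \<noteq> {}" using assms(2,4) by simp_all
  have b: "\<beta> k > 0" if "k \<ge> -1" for k
    using assms(10)[rule_format, of "k + 1"] that by simp
  have dD: "d u = ereal (real_of_ereal (d u))" if "u \<in> Q" for u
    using prox_function_finite[OF d that] .
  have \<psi>0: "\<psi> (-1) u = ereal (\<beta> (-1)) * d u" if "u \<in> Q" for u
    using assms(13) that unfolding auxiliary_functions_def by blast
  have rule: "(\<forall>u\<in>Q. \<psi> (k + 1) u = mirror_descent_value Q d gd lf lam \<beta> x \<psi> k u) \<or>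
      (\<forall>u\<in>Q. \<psi> (k + 1) u = dual_averaging_value d lf lam \<beta> x \<psi> k u)" if "k \<ge> -1" for k
    using assms(13) that unfolding auxiliary_functions_def by blast
  have x: "x (k + 1) \<in> Q" and lam: "lam (k + 1) > 0" if "k \<ge> -1" for k
    using assms(9,11) that by simp_all
  note next_step = auxiliary_function_step[OF Q d assms(6,8) x lam b _ rule]
  define S where "S k u = (\<Sum>i=0..k. lam i * real_of_ereal (lf (x i) u))" for k u
  \<comment> \<open>For \<open>k = -1\<close> the convex part vanishes, and so does the empty sum \<open>S (-1)\<close>.\<close>
  have start: "has_convex_part Q d (\<beta> (-1)) (\<lambda>_. 0) (\<psi> (-1))"
    unfolding has_convex_part_def
  proof (intro conjI ballI)
    show "convex_on Q (\<lambda>_. 0 :: real)" using Q(2) by (simp add: convex_on_def)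
    show "lsc_on Q (\<lambda>_. 0)" by (intro continuous_on_imp_lsc_on continuous_intros)
    fix u assume "u \<in> Q"
    then show "\<psi> (-1) u = ereal (0 + \<beta> (-1) * real_of_ereal (d u))"
      using \<psi>0 dD by (metis add_0 times_ereal.simps(1))
  qed
  have inv: "\<exists>h. has_convex_part Q d (\<beta> k) h (\<psi> k) \<and> (\<forall>u\<in>Q. h u \<le> S k u)" if "k \<ge> -1" for k
    using that
  proof (induction k rule: int_ge_induct)
    case base
    show ?case using start by (auto simp: S_def)
  next
    case (step k)
    then obtain h where h: "has_convex_part Q d (\<beta> k) h (\<psi> k)" "\<And>u. u \<in> Q \<Longrightarrow> h u \<le> S k u"
      by blast
    from next_step(2)[OF step(1) step(1) step(1) h(1) step(1)] obtain h' where
      h': "has_convex_part Q d (\<beta> (k + 1)) h' (\<psi> (k + 1))"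
        "\<And>u. u \<in> Q \<Longrightarrow> h' u \<le> h u + lam (k + 1) * real_of_ereal (lf (x (k + 1)) u)"
      by blast
    have "{0..k + 1} = insert (k + 1) {0..k}" using step(1) by auto
    then have "S (k + 1) u = S k u + lam (k + 1) * real_of_ereal (lf (x (k + 1)) u)" for u
      by (simp add: S_def)
    then have "h' u \<le> S (k + 1) u" if "u \<in> Q" for u
      using h(2)[OF that] h'(2)[OF that] by simp
    with h'(1) show ?case by blast
  qed
  have "\<forall>k\<ge>-1. \<exists>!z. is_arg_min (\<psi> k) (\<lambda>u. u \<in> Q) z"
    using inv has_convex_part_minimizer(1)[OF Q d b] by blast
  moreover have "(INF u\<in>Q. \<psi> (-1) u) = 0" "arg_min_on (\<psi> (-1)) Q = x 0"
  proof -
    have "\<psi> (-1) u < \<psi> (-1) v \<longleftrightarrow> d u < d v" if "u \<in> Q" "v \<in> Q" for u v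
      using b[of "-1"] \<psi>0 dD that
      by (metis less_ereal.simps(1) mult_less_cancel_left_pos order_refl times_ereal.simps(1))
    \<comment> \<open>The two predicates agree, so the choice operator selects the same point for both.\<close>
    then have "is_arg_min (\<psi> (-1)) (\<lambda>u. u \<in> Q) = is_arg_min d (\<lambda>u. u \<in> Q)"
      by (auto simp: is_arg_min_def fun_eq_iff)
    then show z: "arg_min_on (\<psi> (-1)) Q = x 0"
      unfolding assms(12) arg_min_on_def arg_min_def by simp
    have "d (x 0) = 0" using d unfolding assms(12) prox_function_def by blast
    then show "(INF u\<in>Q. \<psi> (-1) u) = 0"
      using has_convex_part_minimizer(3)[OF Q d b start] by (simp add: z)
  qed
  moreover have "\<forall>k\<ge>-1. \<forall>u\<in>Q. \<psi> (k + 1) u \<ge> mirror_descent_value Q d gd lf lam \<beta> x \<psi> k u"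
    using inv next_step(1) by blast
  moreover have "(INF u\<in>Q. \<psi> k u) \<le> (INF u\<in>Q. (\<Sum>i=0..k. ereal (lam i) * lf (x i) u)
      + ereal (\<beta> k) * linearization d gd (arg_min_on (\<psi> k) Q) u)" if "k \<ge> 0" for k
  proof (rule INF_greatest)
    fix u assume u: "u \<in> Q"
    have k: "k \<ge> -1" using that by simp
    from inv[OF k] obtain h where h: "has_convex_part Q d (\<beta> k) h (\<psi> k)" "h u \<le> S k u"
      using u by blast
    note min = has_convex_part_minimizer(2-4)[OF Q d b[OF k] h(1)]
    have "ereal (lam i) * lf (x i) u = ereal (lam i * real_of_ereal (lf (x i) u))" if "i \<in> {0..k}" for i
      using lower_convex_approximation_finite[OF assms(8,6) _ u, of "x i"] assms(11) that
      by (metis atLeastAtMost_iff times_ereal.simps(1))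
    then have "(\<Sum>i=0..k. ereal (lam i) * lf (x i) u) = ereal (S k u)"
      by (simp add: S_def)
    then show "(INF u\<in>Q. \<psi> k u) \<le> (\<Sum>i=0..k. ereal (lam i) * lf (x i) u)
        + ereal (\<beta> k) * linearization d gd (arg_min_on (\<psi> k) Q) u"
      unfolding min(2) linearization_def using min(3)[OF u] h(2)
      by (subst dD[OF min(1)]) (simp add: distrib_left)
  qed
  ultimately show ?thesis unfolding property_1_def by blast
qed

end
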